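(* Let $c(\mathbf{u})=\tfrac12\mathbf{u}^T\mathbf{Q}\mathbf{u}$ on $\mathbb{R}^{2n}$ with $\mathbf{Q}\succ0$ diagonal, let $\beta_1,\dots,\beta_n>0$ be fixed, let $\|\mathbf{B}-\hat{\mathbf{B}}\|\le\epsilon_B$, and suppose the upper bounds of the actions satisfy $\bar{\mathbf{u}}=\mathbf{0}$. Suppose the online exponential barrier algorithm with barrier weights $\alpha^s\in\mathbb{R}^n$ is activated and converges to $\mathbf{u}^s\in[\underline{\mathbf{u}},\bar{\mathbf{u}}]$, i.e. $e_k\ge\bar x_k$ for some $k\in N$ and $$F(\mathbf{u}^s\mid\alpha^s)^T(\mathbf{u}-\mathbf{u}^s)\ge0\qquad\text{for all }\mathbf{u}\in[\underline{\mathbf{u}},\bar{\mathbf{u}}].$$ Let $i=\arg\max_j(\mathbf{b}_j^T\mathbf{u}^s+e_j)$, and let the weights be $\alpha_i^s=\hat\alpha_i+\gamma^s$ and $\alpha_j^s=0$ for $j\in N\setminus\{i\}$, where $\hat\alpha_i$ is the $\alpha_i$-component of the solution to $$\begin{bmatrix}\mathbf{Q}_{A_u}&\hat{\mathbf{b}}_{i,A_u}\\ \hat{\mathbf{b}}_{i,A_u}^T&0\end{bmatrix}\begin{bmatrix}\mathbf{u}_{A_u}\\ \alpha_i\end{bmatrix}=\begin{bmatrix}\mathbf{0}\\ \bar x_i-\hat e_{i,A_u}\end{bmatrix}$$ and $$\gamma^s=\frac{\epsilon_B}{|\hat{\mathbf{b}}_{i,A_u}^T\mathbf{Q}_{A_u}^{-1}\hat{\mathbf{b}}_{i,A_u}|}\left(\|\underline{\mathbf{u}}\|+\|\mathbf{Q}_{A_u}^{-1}\hat{\mathbf{b}}_{i,A_u}\|\,|\hat\alpha_i|\right).$$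 Then $\alpha_i^s\ge0$ and $$\mathbf{b}_i^T\mathbf{u}^s+e_i-\bar x_i\le0 .$$
   Context: $N=\{1,\dots,n\}$. $\mathbf{B}=[\mathbf{R}\ \ \mathbf{X}]\in\mathbb{R}^{n\times2n}$ is the true model with rows $\mathbf{b}_i^T=(b_{i1},\dots,b_{i,2n})$, where $\mathbf{R},\mathbf{X}\in\mathbb{R}^{n\times n}$ are symmetric positive definite with all entries positive; $\hat{\mathbf{B}}\in\mathbb{R}^{n\times2n}$ is an inaccurate estimate with rows $\hat{\mathbf{b}}_i^T=(\hat b_{i1},\dots,\hat b_{i,2n})$, all of whose entries are positive. $\mathbf{e}\in\mathbb{R}^n$ is the vector of voltage deviations when $\mathbf{u}=\mathbf{0}$, and $\bar{\mathbf{x}}\in\mathbb{R}^n$ is the safety limit. $[\underline{\mathbf{u}},\bar{\mathbf{u}}]\subset\mathbb{R}^{2n}$ is the box of admissible actions. Norms are the Euclidean norm for vectors and the induced (spectral) norm for matrices. The map $F$ is $$F(\mathbf{u}\mid\alpha)=\nabla c(\mathbf{u})+\sum_{k=1}^n\alpha_k e^{\beta_k(\mathbf{b}_k^T\mathbf{u}+e_k-\bar x_k)}\hat{\mathbf{b}}_k .$$ The algorithm is activated when the uncontrolled voltages violate the limit ($e_k\ge\bar x_k$ for some $k$) and iterates $\mathbf{u}(k+1)=\mathbf{u}(k)-\eta F(\mathbf{u}(k)\mid\alpha^s)$ subject to the capacity limits $[\underline{\mathbf{u}},\bar{\mathbf{u}}]$, updating the weights $\alpha^s$ according to the current set of unsaturated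 actions and the current attention node (the node with largest voltage deviation); a point of convergence is a solution of the displayed variational inequality with the weights corresponding to that point. An action $j\in\{1,\dots,2n\}$ is saturated if $u_j=\underline u_j$ or $u_j=\bar u_j$ and unsaturated otherwise; $A_u=\{j:\underline u_j<u^s_j<\bar u_j\}$ is the set of unsaturated actions at convergence (assumed nonempty, so that the linear system is uniquely solvable and $\gamma^s$ is defined). The subscript $A_u$ denotes restriction to coordinates in $A_u$ (principal submatrix for $\mathbf{Q}$), and $$\hat e_{i,A_u}=e_i+\sum_{j:\,u^s_j=\underline u_j}\hat b_{ij}\underline u_j+\sum_{j:\,u^s_j=\bar u_j}\hat b_{ij}\bar u_j,$$ a coordinate with $\underline u_j=\bar u_j$ being counted only once. *)

theory Defs
  imports "HOL-Analysis.Analysis"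
begin

text \<open>
  Actions live in \<open>real^('n + 'n)\<close>: the type \<open>'n + 'n\<close> indexes the \<open>2n\<close> coordinates, \<open>Inl\<close> for the
  columns of the first block and \<open>Inr\<close> for those of the second.
\<close>

definition hblock :: "real^'m^'k \<Rightarrow> real^'n^'k \<Rightarrow> real^('m + 'n)^'k" where
  "hblock R X = (\<chi> i j. case j of Inl k \<Rightarrow> R $ i $ k | Inr k \<Rightarrow> X $ i $ k)"

definition diagonal_matrix :: "real^'m^'m \<Rightarrow> bool" where
  "diagonal_matrix Q \<longleftrightarrow> (\<forall>j k. j \<noteq> k \<longrightarrow> Q $ j $ k = 0)"

definition pos_def :: "real^'m^'m \<Rightarrow> bool" where
  "pos_def Q \<longleftrightarrow> transpose Q = Q \<and> (\<forall>x. x \<noteq> 0 \<longrightarrow> x \<bullet> (Q *v x) > 0)"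

text \<open>The norm on the type \<open>real^'m^'k\<close> is the Frobenius norm, so the induced 2-norm is spelled out.\<close>

definition spectral_norm :: "real^'m^'k \<Rightarrow> real" where
  "spectral_norm M = onorm (\<lambda>x. M *v x)"

definition grad :: "('a::real_inner \<Rightarrow> real) \<Rightarrow> 'a \<Rightarrow> 'a" where
  "grad f x = (THE D. GDERIV f x :> D)"

definition quadratic_cost :: "real^'m^'m \<Rightarrow> real^'m \<Rightarrow> real" where
  "quadratic_cost Q u = 1/2 * (u \<bullet> (Q *v u))"

text \<open>
  In \<open>barrier_map\<close> the exponent uses the true model \<open>B\<close> (the voltages are measured), whereas the
  direction uses the estimate \<open>Bh\<close>.
\<close>

definition barrier_map ::
  "(real^'m \<Rightarrow> real) \<Rightarrow> real^'m^'n \<Rightarrow> real^'m^'n \<Rightarrow> real^'n \<Rightarrow> real^'n \<Rightarrow> real^'n \<Rightarrow> real^'n \<Rightarrow> real^'m \<Rightarrow> real^'m"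
where
  "barrier_map c B Bh e xbar \<beta> \<alpha> u =
     grad c u + (\<Sum>k\<in>UNIV. (\<alpha> $ k * exp (\<beta> $ k * (row k B \<bullet> u + e $ k - xbar $ k))) *\<^sub>R row k Bh)"

definition unsaturated :: "real^'m \<Rightarrow> real^'m \<Rightarrow> real^'m \<Rightarrow> 'm set" where
  "unsaturated lo hi u = {j. lo $ j < u $ j \<and> u $ j < hi $ j}"

text \<open>
  For a set \<open>A\<close> of coordinates, the space of vectors indexed by \<open>A\<close> is represented as the subspace of
  vectors vanishing outside \<open>A\<close>, and matrices indexed by \<open>A \<times> A\<close> as matrices vanishing outside
  \<open>A \<times> A\<close>. Inner products, Euclidean norms and matrix products agree with those over the index set
  \<open>A\<close>; the identity matrix over \<open>A\<close> is \<open>sub_mat A (mat 1)\<close>, and \<open>sub_inv A M\<close> is the inverse of the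
  principal submatrix of \<open>M\<close> in the ring of matrices over \<open>A\<close>.
\<close>

definition sub_vec :: "'m set \<Rightarrow> real^'m \<Rightarrow> real^'m" where
  "sub_vec A v = (\<chi> j. if j \<in> A then v $ j else 0)"

definition sub_mat :: "'m set \<Rightarrow> real^'m^'m \<Rightarrow> real^'m^'m" where
  "sub_mat A M = (\<chi> j k. if j \<in> A \<and> k \<in> A then M $ j $ k else 0)"

definition sub_inv :: "'m set \<Rightarrow> real^'m^'m \<Rightarrow> real^'m^'m" where
  "sub_inv A M = (THE W. sub_mat A W = W \<and>
     sub_mat A M ** W = sub_mat A (mat 1) \<and> W ** sub_mat A M = sub_mat A (mat 1))"

text \<open>
  \<open>kkt_solution A Q b r v a\<close>: the pair \<open>(v, a)\<close>, with \<open>v\<close> indexed by \<open>A\<close>, solves the linear system with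
  block matrix \<open>[[Q\<^sub>A, b\<^sub>A], [b\<^sub>A\<^sup>T, 0]]\<close> and right-hand side \<open>(0, r)\<close>.
\<close>

definition kkt_solution ::
  "'m set \<Rightarrow> real^'m^'m \<Rightarrow> real^'m \<Rightarrow> real \<Rightarrow> real^'m \<Rightarrow> real \<Rightarrow> bool"
where
  "kkt_solution A Q b r v a \<longleftrightarrow> sub_vec A v = v \<and>
     sub_mat A Q *v v + a *\<^sub>R sub_vec A b = 0 \<and> sub_vec A b \<bullet> v = r"

text \<open>A saturated coordinate with coinciding bounds contributes only to the first sum.\<close>

definition saturated_dev ::
  "real^'m^'n \<Rightarrow> real^'n \<Rightarrow> real^'m \<Rightarrow> real^'m \<Rightarrow> real^'m \<Rightarrow> 'n \<Rightarrow> real"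
where
  "saturated_dev Bh e lo hi u i = e $ i
     + (\<Sum>j | u $ j = lo $ j. Bh $ i $ j * lo $ j)
     + (\<Sum>j | u $ j = hi $ j \<and> lo $ j \<noteq> hi $ j. Bh $ i $ j * hi $ j)"

end

theory Submission
  imports Defs
begin

text \<open>
  Write \<open>b\<close> for the \<open>i\<close>-th row of the true model, \<open>bh\<close> for that of the estimate, \<open>q\<^sub>j\<close> for the diagonal
  entries of \<open>Q\<close>, \<open>z = b \<bullet> us + e\<^sub>i - xbar\<^sub>i\<close> for the violation at node \<open>i\<close>, and
  \<open>w = \<alpha>\<^sub>i exp (\<beta>\<^sub>i z)\<close> for the effective weight, so that the barrier map at \<open>us\<close> is \<open>Q us + w bh\<close>.

  A variational inequality over a box forces the map to vanish in every unsaturated coordinate: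
  \<open>q\<^sub>j us\<^sub>j = - w bh\<^sub>j\<close> for \<open>j \<in> A\<close>. An unsaturated action lies strictly below its upper bound \<open>0\<close> while
  \<open>q\<^sub>j\<close> and \<open>bh\<^sub>j\<close> are positive; hence \<open>w > 0\<close> and therefore \<open>\<alpha>\<^sub>i > 0\<close>.

  With \<open>S = \<Sum>j\<in>A. bh\<^sub>j\<^sup>2 / q\<^sub>j > 0\<close>, the unsaturated actions contribute \<open>- w S\<close> to \<open>bh \<bullet> us\<close>. The linear
  system has the same shape with \<open>\<alpha>hat\<close> in place of \<open>w\<close>, and its last equation says that the
  contribution \<open>- \<alpha>hat S\<close> would bring the estimated voltage exactly to its limit. Hence the estimated
  violation is \<open>(\<alpha>hat - w) S\<close>, and the true one differs from it by the model error:
  \<open>z = (b - bh) \<bullet> us + (\<alpha>hat - w) S \<le> \<epsilon>B \<parallel>us\<parallel> + (\<alpha>hat - w) S\<close>.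

  If \<open>z\<close> were positive, then \<open>w > \<alpha>\<^sub>i = \<alpha>hat + \<gamma>s\<close> because \<open>\<alpha>\<^sub>i\<close> and \<open>\<beta>\<^sub>i\<close> are positive, so that
  \<open>z < \<epsilon>B \<parallel>us\<parallel> - \<gamma>s S\<close>. But \<open>S\<close> is the denominator in \<open>\<gamma>s\<close>, so \<open>\<gamma>s S \<ge> \<epsilon>B \<parallel>ulo\<parallel>\<close>, and
  \<open>\<parallel>us\<parallel> \<le> \<parallel>ulo\<parallel>\<close> because \<open>ulo \<le> us \<le> 0\<close>. This makes \<open>z\<close> negative, a contradiction.
\<close>

section \<open>Principal submatrices of a diagonal matrix\<close>

text \<open>
  The matrices over \<open>A\<close> form a monoid with unit \<open>sub_mat A (mat 1)\<close>, where two-sided inverses are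
  unique; so exhibiting an inverse determines the description in the definition of \<open>sub_inv\<close>.
\<close>

lemma sub_mat_mult_unit:
  fixes W :: "real^'m^'m"
  assumes "sub_mat A W = W"
  shows "W ** sub_mat A (mat 1) = W" and "sub_mat A (mat 1) ** W = W"
proof -
  have out: "W $ j $ k = 0" if "j \<notin> A \<or> k \<notin> A" for j k
    using that arg_cong[OF assms, of "\<lambda>M. M $ j $ k"] by (auto simp: sub_mat_def)
  have r: "W $ j $ l * (if l \<in> A \<and> k \<in> A then (mat 1 :: real^'m^'m) $ l $ k else 0)
         = (if l = k then W $ j $ k else 0)" for j k l
    using out by (auto simp: mat_def)
  have l: "(if j \<in> A \<and> l \<in> A then (mat 1 :: real^'m^'m) $ j $ l else 0) * W $ l $ k
         = (if l = j then W $ j $ k else 0)" for j k l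
    using out by (auto simp: mat_def)
  show "W ** sub_mat A (mat 1) = W" "sub_mat A (mat 1) ** W = W"
    by (simp_all add: vec_eq_iff matrix_matrix_mult_def sub_mat_def r l)
qed

lemma sub_inv_eqI:
  fixes W M :: "real^'m^'m"
  assumes "sub_mat A W = W"
    and "sub_mat A M ** W = sub_mat A (mat 1)" and "W ** sub_mat A M = sub_mat A (mat 1)"
  shows "sub_inv A M = W"
  unfolding sub_inv_def
proof (rule the_equality)
  show "sub_mat A W = W \<and> sub_mat A M ** W = sub_mat A (mat 1) \<and>
      W ** sub_mat A M = sub_mat A (mat 1)"
    using assms by blast
next
  fix V assume V: "sub_mat A V = V \<and> sub_mat A M ** V = sub_mat A (mat 1) \<and>
      V ** sub_mat A M = sub_mat A (mat 1)"
  have "V = V ** (sub_mat A M ** W)"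
    using V assms(2) by (simp add: sub_mat_mult_unit(1))
  also have "\<dots> = sub_mat A (mat 1) ** W"
    using V by (simp add: matrix_mul_assoc)
  also have "\<dots> = W"
    using assms(1) by (rule sub_mat_mult_unit(2))
  finally show "V = W" .
qed

lemma sub_inv_diagonal_mult_sub_vec:
  fixes Q :: "real^'m^'m"
  assumes "diagonal_matrix Q" and nz: "\<And>j. Q $ j $ j \<noteq> 0"
  shows "sub_inv A Q *v sub_vec A b = (\<chi> j. if j \<in> A then b $ j / Q $ j $ j else 0)"
proof -
  define W :: "real^'m^'m" where "W = (\<chi> j k. if j = k \<and> j \<in> A then 1 / Q $ j $ j else 0)"
  have Q: "Q $ j $ k = (if j = k then Q $ j $ j else 0)" for j k
    using assms(1) by (auto simp: diagonal_matrix_def)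
  have l: "(if j \<in> A \<and> l \<in> A then Q $ j $ l else 0) * (if l = k \<and> l \<in> A then 1 / Q $ l $ l else 0)
         = (if l = j then (if j = k \<and> j \<in> A then 1 else 0) else 0)" for j k l
    using nz by (subst Q) auto
  have r: "(if j = l \<and> j \<in> A then 1 / Q $ j $ j else 0) * (if l \<in> A \<and> k \<in> A then Q $ l $ k else 0)
         = (if l = j then (if j = k \<and> j \<in> A then 1 else 0) else 0)" for j k l
    using nz by (subst (2) Q) auto
  have "sub_inv A Q = W"
  proof (rule sub_inv_eqI)
    show "sub_mat A W = W"
      by (auto simp: vec_eq_iff W_def sub_mat_def)
    show "sub_mat A Q ** W = sub_mat A (mat 1)"
      by (auto simp: vec_eq_iff matrix_matrix_mult_def W_def sub_mat_def mat_def l)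
    show "W ** sub_mat A Q = sub_mat A (mat 1)"
      by (auto simp: vec_eq_iff matrix_matrix_mult_def W_def sub_mat_def mat_def r)
  qed
  moreover have "(if j = l \<and> j \<in> A then 1 / Q $ j $ j else 0) * (if l \<in> A then b $ l else 0)
      = (if l = j then (if j \<in> A then b $ j / Q $ j $ j else 0) else 0)" for j l
    by auto
  ultimately show ?thesis
    by (simp add: vec_eq_iff matrix_vector_mult_def W_def sub_vec_def)
qed

lemma diagonal_mult_vec_nth:
  fixes Q :: "real^'m^'m"
  assumes "diagonal_matrix Q"
  shows "(Q *v x) $ j = Q $ j $ j * x $ j"
proof -
  have "(\<Sum>k\<in>UNIV. Q $ j $ k * x $ k) = (\<Sum>k\<in>UNIV. if k = j then Q $ j $ k * x $ k else 0)"
    using assms by (intro sum.cong) (auto simp: diagonal_matrix_def)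
  then show ?thesis
    by (simp add: matrix_vector_mult_def)
qed

lemma pos_def_diag_pos:
  assumes "pos_def Q"
  shows "Q $ j $ j > 0"
proof -
  have "axis j 1 \<bullet> (Q *v axis j 1) > 0"
    using assms by (auto simp: pos_def_def axis_eq_0_iff)
  then show ?thesis
    by (simp add: inner_axis' matrix_vector_mul_component inner_axis)
qed

section \<open>The barrier map at a solution of the variational inequality\<close>

lemma grad_quadratic_cost:
  fixes Q :: "real^'m^'m"
  assumes "transpose Q = Q"
  shows "grad (quadratic_cost Q) u = Q *v u"
proof -
  have sym: "x \<bullet> (Q *v y) = y \<bullet> (Q *v x)" for x y
    using assms by (metis dot_lmul_matrix inner_commute transpose_matrix_vector)
  have "((\<lambda>x. Q *v x) has_derivative (\<lambda>h. Q *v h)) (at u)"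
    by (rule linear_imp_has_derivative) simp
  then have "(quadratic_cost Q has_derivative (\<lambda>h. 1/2 * (u \<bullet> (Q *v h) + h \<bullet> (Q *v u)))) (at u)"
    unfolding quadratic_cost_def[abs_def] by (auto intro!: derivative_eq_intros)
  then have G: "GDERIV (quadratic_cost Q) u :> Q *v u"
    unfolding gderiv_def by (simp add: sym[of u])
  show ?thesis
    unfolding grad_def
  proof (rule the_equality[where P = "\<lambda>D. GDERIV (quadratic_cost Q) u :> D", OF G])
    fix D assume "GDERIV (quadratic_cost Q) u :> D"
    then have "(\<lambda>h. h \<bullet> D) = (\<lambda>h. h \<bullet> (Q *v u))"
      using G unfolding gderiv_def by (rule has_derivative_unique)
    then show "D = Q *v u"
      by (metis vector_eq_ldot)
  qed
qed

text \<open>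
  Moving a single coordinate to either of its bounds stays in the box, and from a point strictly
  between the bounds these two moves have opposite signs.
\<close>

lemma box_variational_inequality_interior_zero:
  fixes F u lo hi :: "real^'m"
  assumes u: "u \<in> {lo..hi}" and vi: "\<forall>w\<in>{lo..hi}. F \<bullet> (w - u) \<ge> 0"
    and j: "j \<in> unsaturated lo hi u"
  shows "F $ j = 0"
proof -
  have move: "F $ j * (c - u $ j) \<ge> 0" if "lo $ j \<le> c" "c \<le> hi $ j" for c
  proof -
    have "u + axis j (c - u $ j) \<in> {lo..hi}"
      using u that by (auto simp: less_eq_vec_def axis_def)
    with vi have "F \<bullet> (u + axis j (c - u $ j) - u) \<ge> 0"
      by blast
    then show ?thesis
      by (simp add: inner_axis)
  qed
  have "lo $ j < u $ j" "u $ j < hi $ j"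
    using j by (auto simp: unsaturated_def)
  with move[of "lo $ j"] move[of "hi $ j"] show ?thesis
    by (auto simp: zero_le_mult_iff)
qed

text \<open>
  Every coordinate is either unsaturated or at one of its bounds. Assigning those with coinciding
  bounds to the lower one makes the three index sets disjoint, so the inner product splits.
\<close>

lemma inner_eq_unsaturated_plus_saturated_dev:
  fixes u lo hi :: "real^'m"
  assumes u: "u \<in> {lo..hi}"
  shows "row i Bh \<bullet> u + e $ i
       = (\<Sum>j\<in>unsaturated lo hi u. Bh $ i $ j * u $ j) + saturated_dev Bh e lo hi u i"
proof -
  let ?U = "unsaturated lo hi u" and ?L = "{j. u $ j = lo $ j}"
    and ?H = "{j. u $ j = hi $ j \<and> lo $ j \<noteq> hi $ j}"
  have "UNIV = ?U \<union> (?L \<union> ?H)"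
    using u by (auto simp: unsaturated_def less_eq_vec_def order.order_iff_strict)
  then have "row i Bh \<bullet> u = (\<Sum>j\<in>?U \<union> (?L \<union> ?H). Bh $ i $ j * u $ j)"
    by (simp add: inner_vec_def row_def)
  also have "\<dots> = (\<Sum>j\<in>?U. Bh $ i $ j * u $ j) + (\<Sum>j\<in>?L \<union> ?H. Bh $ i $ j * u $ j)"
    by (rule sum.union_disjoint) (auto simp: unsaturated_def)
  also have "(\<Sum>j\<in>?L \<union> ?H. Bh $ i $ j * u $ j)
      = (\<Sum>j\<in>?L. Bh $ i $ j * u $ j) + (\<Sum>j\<in>?H. Bh $ i $ j * u $ j)"
    by (rule sum.union_disjoint) auto
  finally show ?thesis
    by (simp add: saturated_dev_def)
qed

section \<open>The model error and the robustness margin\<close>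

lemma row_inner_le_spectral_norm:
  fixes M :: "real^'m^'k"
  shows "\<bar>row i M \<bullet> x\<bar> \<le> spectral_norm M * norm x"
proof -
  have "\<bar>row i M \<bullet> x\<bar> = \<bar>(M *v x) $ i\<bar>"
    by (simp add: matrix_vector_mul_component row_def vec_lambda_eta)
  also have "\<dots> \<le> norm (M *v x)"
    by (rule component_le_norm_cart)
  also have "\<dots> \<le> spectral_norm M * norm x"
    unfolding spectral_norm_def by (rule onorm) (rule matrix_vector_mul_bounded_linear)
  finally show ?thesis .
qed

lemma spectral_norm_nonneg: "spectral_norm M \<ge> 0"
  unfolding spectral_norm_def by (rule onorm_pos_le) (rule matrix_vector_mul_bounded_linear)

theorem theorem3:
  fixes R X :: "real^'n^'n"
    and B Bh :: "real^('n + 'n)^'n"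
    and Q :: "real^('n + 'n)^('n + 'n)"
    and e xbar \<beta> \<alpha>s :: "real^'n"
    and ulo uhi us v :: "real^('n + 'n)"
    and \<epsilon>B \<alpha>hat \<gamma>s :: real
    and i :: 'n
    and A :: "('n + 'n) set"
  assumes "pos_def R" and "\<And>k l. R $ k $ l > 0"
    and "pos_def X" and "\<And>k l. X $ k $ l > 0"
    and "B = hblock R X"
    and "\<And>k j. Bh $ k $ j > 0"
    and "diagonal_matrix Q" and "pos_def Q"
    and "\<And>k. \<beta> $ k > 0"
    and "spectral_norm (B - Bh) \<le> \<epsilon>B"
    and "uhi = 0"
    and activated: "\<exists>k. e $ k \<ge> xbar $ k"
    and "us \<in> {ulo..uhi}"
    and convergence: "\<forall>u\<in>{ulo..uhi}.
          barrier_map (quadratic_cost Q) B Bh e xbar \<beta> \<alpha>s us \<bullet> (u - us) \<ge> 0"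
    and "is_arg_max (\<lambda>j. row j B \<bullet> us + e $ j) (\<lambda>j. True) i"
    and "A = unsaturated ulo uhi us" and "A \<noteq> {}"
    and "kkt_solution A Q (row i Bh) (xbar $ i - saturated_dev Bh e ulo uhi us i) v \<alpha>hat"
    and "\<gamma>s = \<epsilon>B / \<bar>sub_vec A (row i Bh) \<bullet> (sub_inv A Q *v sub_vec A (row i Bh))\<bar>
               * (norm ulo + norm (sub_inv A Q *v sub_vec A (row i Bh)) * \<bar>\<alpha>hat\<bar>)"
    and "\<alpha>s $ i = \<alpha>hat + \<gamma>s"
    and "\<And>j. j \<noteq> i \<Longrightarrow> \<alpha>s $ j = 0"
  shows "\<alpha>s $ i \<ge> 0 \<and> row i B \<bullet> us + e $ i - xbar $ i \<le> 0"
proof -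
  define bh where "bh = row i Bh"
  define q where "q j = Q $ j $ j" for j
  define z where "z = row i B \<bullet> us + e $ i - xbar $ i"
  define w where "w = \<alpha>s $ i * exp (\<beta> $ i * z)"
  define S where "S = (\<Sum>j\<in>A. bh $ j * bh $ j / q j)"
  have bh_pos: "bh $ j > 0" for j
    using assms(6) by (simp add: bh_def row_def)
  have q_pos: "q j > 0" for j
    using pos_def_diag_pos[OF \<open>pos_def Q\<close>] by (simp add: q_def)
  have box: "ulo \<le> us" "us \<le> 0"
    using \<open>us \<in> {ulo..uhi}\<close> \<open>uhi = 0\<close> by auto

  have S_pos: "S > 0"
    unfolding S_def using \<open>A \<noteq> {}\<close> bh_pos q_pos by (intro sum_pos) auto
  have inv: "sub_inv A Q *v sub_vec A bh = (\<chi> j. if j \<in> A then bh $ j / q j else 0)"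
    unfolding q_def using \<open>diagonal_matrix Q\<close> q_pos
    by (intro sub_inv_diagonal_mult_sub_vec) (simp_all add: q_def less_imp_neq[symmetric])
  have S_eq: "sub_vec A bh \<bullet> (sub_inv A Q *v sub_vec A bh) = S"
  proof -
    have "sub_vec A bh \<bullet> (sub_inv A Q *v sub_vec A bh)
        = (\<Sum>j\<in>UNIV. if j \<in> A then bh $ j * bh $ j / q j else 0)"
      unfolding inv by (auto simp: inner_vec_def sub_vec_def intro!: sum.cong)
    then show ?thesis
      by (simp add: S_def flip: sum.inter_filter)
  qed

  \<comment> \<open>Node \<open>i\<close> alone carries a nonzero weight, so the barrier sum collapses to one term.\<close>
  have "barrier_map (quadratic_cost Q) B Bh e xbar \<beta> \<alpha>s us = Q *v us + w *\<^sub>R bh"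
  proof -
    have "(\<Sum>k\<in>UNIV. (\<alpha>s $ k * exp (\<beta> $ k * (row k B \<bullet> us + e $ k - xbar $ k))) *\<^sub>R row k Bh)
        = (\<Sum>k\<in>UNIV. if k = i then w *\<^sub>R bh else 0)"
      by (rule sum.cong) (auto simp: w_def z_def bh_def assms(21))
    then show ?thesis
      using \<open>pos_def Q\<close> by (simp add: barrier_map_def grad_quadratic_cost pos_def_def)
  qed
  then have "(Q *v us + w *\<^sub>R bh) $ j = 0" if "j \<in> A" for j
    using box_variational_inequality_interior_zero[OF \<open>us \<in> {ulo..uhi}\<close> convergence] that \<open>A = _\<close>
    by simp
  then have stationary: "q j * us $ j = - w * bh $ j" if "j \<in> A" for j
    using that by (simp add: diagonal_mult_vec_nth[OF \<open>diagonal_matrix Q\<close>] q_def eq_neg_iff_add_eq_0)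

  have alpha_pos: "\<alpha>s $ i > 0"
  proof -
    obtain j where j: "j \<in> A"
      using \<open>A \<noteq> {}\<close> by blast
    then have "us $ j < 0"
      using \<open>A = _\<close> \<open>uhi = 0\<close> by (simp add: unsaturated_def)
    then have "q j * us $ j < 0"
      using q_pos by (simp add: mult_pos_neg)
    then have "0 < w * bh $ j"
      using stationary[OF j] by simp
    then have "w > 0"
      using bh_pos[of j] by (simp add: zero_less_mult_iff)
    then show ?thesis
      by (simp add: w_def zero_less_mult_iff)
  qed

  \<comment> \<open>The linear system has the shape of the stationarity condition, with \<open>\<alpha>hat\<close> in place of \<open>w\<close>.\<close>
  have target: "- \<alpha>hat * S = xbar $ i - saturated_dev Bh e ulo uhi us i"
  proof -
    have K: "sub_vec A v = v" "sub_mat A Q *v v + \<alpha>hat *\<^sub>R sub_vec A bh = 0"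
      "sub_vec A bh \<bullet> v = xbar $ i - saturated_dev Bh e ulo uhi us i"
      using assms(18) by (auto simp: kkt_solution_def bh_def)
    have v: "bh $ j * v $ j = - \<alpha>hat * (bh $ j * bh $ j / q j)" if "j \<in> A" for j
    proof -
      have "diagonal_matrix (sub_mat A Q)"
        using \<open>diagonal_matrix Q\<close> by (simp add: diagonal_matrix_def sub_mat_def)
      then have "q j * v $ j + \<alpha>hat * bh $ j = 0"
        using arg_cong[OF K(2), of "\<lambda>x. x $ j"] that
        by (simp add: diagonal_mult_vec_nth q_def sub_mat_def sub_vec_def)
      then have "v $ j = - \<alpha>hat * bh $ j / q j"
        using q_pos[of j]
        by (metis add_eq_0_iff2 less_numeral_extra(3) mult_minus_left nonzero_mult_div_cancel_left)
      then show ?thesis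
        by simp
    qed
    have "sub_vec A bh \<bullet> v = (\<Sum>j\<in>UNIV. if j \<in> A then bh $ j * v $ j else 0)"
      by (auto simp: inner_vec_def sub_vec_def intro!: sum.cong)
    also have "\<dots> = (\<Sum>j\<in>A. bh $ j * v $ j)"
      by (simp flip: sum.inter_filter)
    also have "\<dots> = - \<alpha>hat * S"
      unfolding S_def sum_distrib_left using v by (intro sum.cong) auto
    finally show ?thesis
      using K(3) by simp
  qed
  have estimated: "bh \<bullet> us + e $ i - xbar $ i = (\<alpha>hat - w) * S"
  proof -
    have "bh $ j * us $ j = - w * (bh $ j * bh $ j / q j)" if "j \<in> A" for j
    proof -
      have "us $ j = - w * bh $ j / q j"
        using stationary[OF that] q_pos[of j]
        by (metis less_numeral_extra(3) nonzero_mult_div_cancel_left)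
      then show ?thesis
        by simp
    qed
    then have "(\<Sum>j\<in>A. bh $ j * us $ j) = - w * S"
      unfolding S_def sum_distrib_left by (intro sum.cong) auto
    then show ?thesis
      using inner_eq_unsaturated_plus_saturated_dev[OF \<open>us \<in> {ulo..uhi}\<close>, of i Bh e] target \<open>A = _\<close>
      by (simp add: bh_def row_def vec_lambda_eta algebra_simps)
  qed

  have eps_nonneg: "\<epsilon>B \<ge> 0"
    using spectral_norm_nonneg[of "B - Bh"] assms(10) by linarith
  have norm_us: "norm us \<le> norm ulo"
  proof (rule norm_le_componentwise_cart)
    fix j show "norm (us $ j) \<le> norm (ulo $ j)"
      using box[unfolded less_eq_vec_def, THEN spec[of _ j]] by simp
  qed
  have model_error: "row i B \<bullet> us - bh \<bullet> us \<le> \<epsilon>B * norm ulo"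
  proof -
    have "row i B \<bullet> us - bh \<bullet> us = row i (B - Bh) \<bullet> us"
      by (simp add: bh_def row_def inner_vec_def sum_subtractf algebra_simps)
    also have "\<dots> \<le> spectral_norm (B - Bh) * norm us"
      using row_inner_le_spectral_norm[of i "B - Bh" us] by linarith
    also have "\<dots> \<le> \<epsilon>B * norm us"
      using assms(10) by (rule mult_right_mono) simp
    also have "\<dots> \<le> \<epsilon>B * norm ulo"
      using norm_us eps_nonneg by (rule mult_left_mono)
    finally show ?thesis .
  qed
  have margin: "\<epsilon>B * norm ulo \<le> \<gamma>s * S"
  proof -
    have "\<gamma>s * S = \<epsilon>B * (norm ulo + norm (sub_inv A Q *v sub_vec A bh) * \<bar>\<alpha>hat\<bar>)"
      using assms(19) S_eq S_pos by (simp add: bh_def)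
    then show ?thesis
      using eps_nonneg by (simp add: mult_left_mono)
  qed

  have "z \<le> 0"
  proof (rule ccontr)
    assume "\<not> z \<le> 0"
    then have "exp (\<beta> $ i * z) > 1"
      using assms(9)[of i] by simp
    then have "w > \<alpha>hat + \<gamma>s"
      using alpha_pos \<open>\<alpha>s $ i = \<alpha>hat + \<gamma>s\<close> by (simp add: w_def)
    then have "(\<alpha>hat - w) * S < - \<gamma>s * S"
      using S_pos by (intro mult_strict_right_mono) auto
    then have "z < 0"
      using model_error margin estimated by (simp add: z_def)
    with \<open>\<not> z \<le> 0\<close> show False
      by simp
  qed
  with alpha_pos show ?thesis
    by (simp add: z_def)
qed

end
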